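(* Every DI9 logical truth of $L$ is a tautology.
   Context: $L$ is a standard language of classical propositional logic: its formulas are built recursively from an infinite set of atomic formulas by the primitive connectives negation ($\sim$) and disjunction ($\vee$). "Number" means real number. There are three distinct values $T, F, 0$; $T$ and $F$ are called truth values. A DI9 valuation for $L$ is a function $\alpha$ from (atomic formulas of $L$) $\times\ \mathbb{R}$ to $\{T,F,0\}$ such that for every atomic formula $A$: (1) for all numbers $j<h$, if $\alpha(A,j)=T$ then $\alpha(A,h)=T$, and if $\alpha(A,j)=F$ then $\alpha(A,h)=F$; (2) there is a number $j$ with $\alpha(A,j)=T$ or $\alpha(A,j)=F$. For a DI9 valuation $\alpha$, the DI9 classical interpretation associated to $\alpha$ is the function $\alpha^*$ from formulas of $L$ to $\{T,F\}$ such that: for atomic $A$, $\alpha^*(A)=T$ iff there is a $j$ with $\alpha(A,j)=T$; $\alpha^*(\sim B)=T$ iff $\alpha^*(B)=F$; $\alpha^*(B\vee C)=T$ iff $\alpha^*(B)=T$ or $\alpha^*(C)=T$. For a number $j$, a DI9 valuation $\beta$ is a $j$-extension of a DI9 valuation $\alpha$ iff $\beta(A,h)=\alpha(A,h)$ for every atomic formula $A$ and every number $h\le j$. For a DI9 valuation $\alpha$, the DI9 interpretation $I\alpha$ is the function from (formulas of $L$) $\times\ \mathbb{R}$ to $\{T,F,0\}$ defined recursively by: $I\alpha(A,j)=\alpha(A,j)$ for atomic $A$; $I\alpha(\sim B,j)=T$ iff $I\alpha(B,j)=F$, $I\alpha(\sim B,j)=F$ iff $I\alpha(B,j)=T$,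 $I\alpha(\sim B,j)=0$ iff $I\alpha(B,j)=0$; $I\alpha(B\vee C,j)=T$ iff for every $j$-extension $\beta$ of $\alpha$, $\beta^*(B)=T$ or $\beta^*(C)=T$; $I\alpha(B\vee C,j)=F$ iff for every $j$-extension $\beta$ of $\alpha$, $\beta^*(B)=F$ and $\beta^*(C)=F$; and $I\alpha(B\vee C,j)=0$ otherwise. $I\alpha$ satisfies a formula $A$ at a number $j$ iff $I\alpha(A,j)=T$. A formula $A$ is a DI9 logical consequence of a set $\Gamma$ of formulas iff, for every number $j$, every DI9 interpretation for $L$ that satisfies all elements of $\Gamma$ at $j$ also satisfies $A$ at $j$. $A$ is a DI9 logical truth iff it is a DI9 logical consequence of the empty set (equivalently, every DI9 interpretation satisfies $A$ at every number). An interpretation for $L$ in the sense of classical semantics is a function $v$ from formulas of $L$ to $\{T,F\}$ with $v(\sim B)=T$ iff $v(B)=F$, and $v(B\vee C)=T$ iff $v(B)=T$ or $v(C)=T$. A formula $A$ is a tautology iff $v(A)=T$ for every such $v$. *)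

theory Defs
  imports Complex_Main
begin

(* The atomic formulas are the elements of a type; that there are infinitely many
   of them is a hypothesis (infinite UNIV) of the theorem. *)
datatype 'a form =
    Atom 'a
  | Neg "'a form"
  | Disj "'a form" "'a form"

datatype tval = T | F | Zero

definition DI9_valuation :: "('a \<Rightarrow> real \<Rightarrow> tval) \<Rightarrow> bool" where
  "DI9_valuation \<alpha> \<longleftrightarrow>
     (\<forall>A. (\<forall>j h. j < h \<longrightarrow>
             (\<alpha> A j = T \<longrightarrow> \<alpha> A h = T) \<and> (\<alpha> A j = F \<longrightarrow> \<alpha> A h = F)) \<and>
          (\<exists>j. \<alpha> A j = T \<or> \<alpha> A j = F))"

primrec DI9_classical :: "('a \<Rightarrow> real \<Rightarrow> tval) \<Rightarrow> 'a form \<Rightarrow> tval" where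
  "DI9_classical \<alpha> (Atom A) = (if \<exists>j. \<alpha> A j = T then T else F)"
| "DI9_classical \<alpha> (Neg B) = (if DI9_classical \<alpha> B = F then T else F)"
| "DI9_classical \<alpha> (Disj B C) =
     (if DI9_classical \<alpha> B = T \<or> DI9_classical \<alpha> C = T then T else F)"

definition DI9_extension ::
  "real \<Rightarrow> ('a \<Rightarrow> real \<Rightarrow> tval) \<Rightarrow> ('a \<Rightarrow> real \<Rightarrow> tval) \<Rightarrow> bool" where
  "DI9_extension j \<alpha> \<beta> \<longleftrightarrow>
     DI9_valuation \<alpha> \<and> DI9_valuation \<beta> \<and> (\<forall>A h. h \<le> j \<longrightarrow> \<beta> A h = \<alpha> A h)"

(* In the clause for disjunction the order of the two tests is immaterial when \<alpha> is a
   DI9 valuation, since \<alpha> is then a j-extension of itself; see DI9_int_Disj_T_F below. *)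
primrec DI9_int :: "('a \<Rightarrow> real \<Rightarrow> tval) \<Rightarrow> 'a form \<Rightarrow> real \<Rightarrow> tval" where
  "DI9_int \<alpha> (Atom A) j = \<alpha> A j"
| "DI9_int \<alpha> (Neg B) j =
     (case DI9_int \<alpha> B j of T \<Rightarrow> F | F \<Rightarrow> T | Zero \<Rightarrow> Zero)"
| "DI9_int \<alpha> (Disj B C) j =
     (if \<forall>\<beta>. DI9_extension j \<alpha> \<beta> \<longrightarrow> DI9_classical \<beta> B = T \<or> DI9_classical \<beta> C = T then T
      else if \<forall>\<beta>. DI9_extension j \<alpha> \<beta> \<longrightarrow> DI9_classical \<beta> B = F \<and> DI9_classical \<beta> C = F then F
      else Zero)"

lemma DI9_int_Disj_T_F:
  assumes "DI9_valuation \<alpha>"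
  shows "DI9_int \<alpha> (Disj B C) j = T \<longleftrightarrow>
           (\<forall>\<beta>. DI9_extension j \<alpha> \<beta> \<longrightarrow> DI9_classical \<beta> B = T \<or> DI9_classical \<beta> C = T)"
    and "DI9_int \<alpha> (Disj B C) j = F \<longleftrightarrow>
           (\<forall>\<beta>. DI9_extension j \<alpha> \<beta> \<longrightarrow> DI9_classical \<beta> B = F \<and> DI9_classical \<beta> C = F)"
proof -
  have "DI9_extension j \<alpha> \<alpha>"
    using assms by (simp add: DI9_extension_def)
  then show "DI9_int \<alpha> (Disj B C) j = T \<longleftrightarrow>
           (\<forall>\<beta>. DI9_extension j \<alpha> \<beta> \<longrightarrow> DI9_classical \<beta> B = T \<or> DI9_classical \<beta> C = T)"
    and "DI9_int \<alpha> (Disj B C) j = F \<longleftrightarrow>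
           (\<forall>\<beta>. DI9_extension j \<alpha> \<beta> \<longrightarrow> DI9_classical \<beta> B = F \<and> DI9_classical \<beta> C = F)"
    by (auto split: if_splits)
qed

definition DI9_interpretation :: "('a form \<Rightarrow> real \<Rightarrow> tval) \<Rightarrow> bool" where
  "DI9_interpretation I \<longleftrightarrow> (\<exists>\<alpha>. DI9_valuation \<alpha> \<and> I = DI9_int \<alpha>)"

definition satisfies_at :: "('a form \<Rightarrow> real \<Rightarrow> tval) \<Rightarrow> 'a form \<Rightarrow> real \<Rightarrow> bool" where
  "satisfies_at I A j \<longleftrightarrow> I A j = T"

definition DI9_consequence :: "'a form set \<Rightarrow> 'a form \<Rightarrow> bool" where
  "DI9_consequence \<Gamma> A \<longleftrightarrow>
     (\<forall>j I. DI9_interpretation I \<longrightarrow> (\<forall>B\<in>\<Gamma>. satisfies_at I B j) \<longrightarrow> satisfies_at I A j)"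

definition DI9_logical_truth :: "'a form \<Rightarrow> bool" where
  "DI9_logical_truth A \<longleftrightarrow> DI9_consequence {} A"

definition classical_interpretation :: "('a form \<Rightarrow> tval) \<Rightarrow> bool" where
  "classical_interpretation v \<longleftrightarrow>
     (\<forall>A. v A \<in> {T, F}) \<and>
     (\<forall>B. v (Neg B) = T \<longleftrightarrow> v B = F) \<and>
     (\<forall>B C. v (Disj B C) = T \<longleftrightarrow> v B = T \<or> v C = T)"

definition tautology :: "'a form \<Rightarrow> bool" where
  "tautology A \<longleftrightarrow> (\<forall>v. classical_interpretation v \<longrightarrow> v A = T)"

end

(* A classical interpretation v yields the valuation giving each atom A the value v A at all
   times. Every DI9 truth value agrees with the associated classical value, because a
   valuation is an extension of itself; and here the associated classical interpretation
   is v. *)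
theory Submission
  imports Defs
begin

lemma DI9_classical_eq_if_DI9_int_neq_Zero:
  assumes "DI9_valuation \<alpha>" and "DI9_int \<alpha> A j \<noteq> Zero"
  shows "DI9_classical \<alpha> A = DI9_int \<alpha> A j"
  using assms(2)
proof (induction A)
  case (Atom a)
  \<comment> \<open>Truth values persist in time, so whichever of \<open>h\<close> and
    \<open>j\<close> is earlier fixes the later value; thus F at \<open>j\<close> rules out T at
    every time.\<close>
  have "\<not> (\<alpha> a h = T \<and> \<alpha> a j = F)" for h
    using assms(1) unfolding DI9_valuation_def
    by (metis linorder_less_linear tval.distinct(1))
  then show ?case
    using Atom by (cases "\<alpha> a j") auto
next
  case (Neg B)
  then show ?case
    by (cases "DI9_int \<alpha> B j") auto
next
  case (Disj B C)
  \<comment> \<open>Taking \<beta> = \<alpha> in the quantifier over extensions leaves the classical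
    clause.\<close>
  have "DI9_extension j \<alpha> \<alpha>"
    using assms(1) by (simp add: DI9_extension_def)
  then show ?case
    using Disj.prems by (auto split: if_splits)
qed

lemma DI9_valuation_const:
  assumes "classical_interpretation v"
  shows "DI9_valuation (\<lambda>a h. v (Atom a))"
  using assms unfolding DI9_valuation_def classical_interpretation_def by auto

text \<open>The clauses for \<open>v\<close> only say when it is T; two-valuedness supplies
  F.\<close>

lemma DI9_classical_const:
  assumes "classical_interpretation v"
  shows "DI9_classical (\<lambda>a h. v (Atom a)) A = v A"
  using assms unfolding classical_interpretation_def
  by (induction A) (auto, (metis insertE singletonD)+)

theorem mainTheorem4:
  fixes A :: "'a form"
  assumes "infinite (UNIV :: 'a set)"
    and "DI9_logical_truth A"
  shows "tautology A"
  unfolding tautology_def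
proof (intro allI impI)
  fix v :: "'a form \<Rightarrow> tval"
  assume v: "classical_interpretation v"
  let ?\<alpha> = "\<lambda>a h. v (Atom a)"
  \<comment> \<open>The time 0 is arbitrary.\<close>
  have "DI9_int ?\<alpha> A 0 = T"
    using assms(2) DI9_valuation_const[OF v]
    by (auto simp: DI9_logical_truth_def DI9_consequence_def DI9_interpretation_def
        satisfies_at_def)
  then have "DI9_classical ?\<alpha> A = T"
    using DI9_classical_eq_if_DI9_int_neq_Zero[OF DI9_valuation_const[OF v], of A 0] by simp
  then show "v A = T"
    using DI9_classical_const[OF v] by simp
qed

end
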